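(* Let $(V,E,<)$ be a nonempty wellordered connected graph with algorithmic traversal $\prec$ and traversal least neighbor function $p^\star$. Suppose $W\subseteq V$ is nonempty and closed under $p^\star$, except for possibly at its $\prec$-least element $w_0$ (that is, $p^\star(w)\in W$ for every $w\in W\setminus\{w_0\}$). Then $W$ induces a connected subgraph of $(V,E)$, and the algorithmic traversal $(W,\triangleleft)$ starting with $w_0$ of that subgraph (with $W$ ordered by the restriction of $<$) agrees with $\prec$ on $W$.
   Context: A wellordered connected graph $(V,E,<)$ is a connected undirected graph $(V,E)$ (possibly infinite) together with a wellordering $<$ of $V$. Deterministic graph search on $(V,E,<)$ starting with a vertex $v$ defines sets $S_\alpha\subseteq V$ by transfinite recursion: $S_0=\emptyset$; $S_1=\{v\}$; for $\beta\ge 1$, $S_{\beta+1}$ is obtained from $S_\beta$ by adding the $<$-least element of $\{u\in V\setminus S_\beta:\exists w\in S_\beta\ E(w,u)\}$ if this set is nonempty, and $S_{\beta+1}=S_\beta$ otherwise; and $S_\alpha=\bigcup_{\beta<\alpha}S_\beta$ at limit $\alpha$. Every vertex eventually enters some $S_\alpha$. The algorithmic traversal starting with $v$ is the wellordering of $V$ in which $u$ precedes $w$ iff the least $\alpha$ with $u\in S_\alpha$ is less than the least $\alpha$ with $w\in S_\alpha$. When no starting vertex is mentioned, the search starts with the $<$-least element of $V$. The traversal least neighbor function $p^\star$ takes each vertex other than the least element of $V$ to its $\prec$-least neighbor, and is undefined on the least element. *)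

theory Defs
  imports Main
begin

section \<open>Ordinal stages\<close>

text \<open>
  HOL has no type of all ordinals.  The stages of a search in a graph with vertices of
  type \<open>'a\<close> are indexed by the points of an initial ordinal of cardinality
  \<open>2^(|'a| + \<aleph>\<^sub>0)\<close>, identified with the ordinals below it.  It is a limit ordinal, and it is
  longer than every wellordering of a set of vertices, so that every search is exhausted
  before the indices are (see \<open>vertex_enters\<close> below).
\<close>

typedef 'a ordinal = "UNIV :: ('a + nat) set set" by simp

instantiation ordinal :: (type) wellorder
begin

definition less_eq_ordinal :: "'a ordinal \<Rightarrow> 'a ordinal \<Rightarrow> bool" where
  "\<alpha> \<le> \<beta> \<longleftrightarrow> (Rep_ordinal \<alpha>, Rep_ordinal \<beta>) \<in> card_of UNIV"

definition less_ordinal :: "'a ordinal \<Rightarrow> 'a ordinal \<Rightarrow> bool" where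
  "(\<alpha> :: 'a ordinal) < \<beta> \<longleftrightarrow> \<alpha> \<le> \<beta> \<and> \<alpha> \<noteq> \<beta>"

instance
proof -
  let ?r = "card_of (UNIV :: ('a + nat) set set)"
  have W: "well_order_on UNIV ?r"
    by (rule card_of_well_order_on)
  then have L: "refl_on UNIV ?r" "trans ?r" "antisym ?r" "total_on UNIV ?r" "wf (?r - Id)"
    by (auto simp: well_order_on_def linear_order_on_def partial_order_on_def preorder_on_def)
  show "OFCLASS('a ordinal, wellorder_class)"
  proof
    fix \<alpha> \<beta> \<gamma> :: "'a ordinal"
    show "\<alpha> \<le> \<alpha>"
      using L(1) by (auto simp: less_eq_ordinal_def refl_on_def)
    show "\<alpha> \<le> \<beta> \<Longrightarrow> \<beta> \<le> \<gamma> \<Longrightarrow> \<alpha> \<le> \<gamma>"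
      using L(2) unfolding less_eq_ordinal_def by (rule transD)
    show anti: "\<alpha> \<le> \<beta> \<Longrightarrow> \<beta> \<le> \<alpha> \<Longrightarrow> \<alpha> = \<beta>"
      using L(3) unfolding less_eq_ordinal_def by (auto dest: antisymD simp: Rep_ordinal_inject)
    show "(\<alpha> < \<beta>) = (\<alpha> \<le> \<beta> \<and> \<not> \<beta> \<le> \<alpha>)"
      using L(1,3) unfolding less_ordinal_def less_eq_ordinal_def
      by (auto simp: refl_on_def Rep_ordinal_inject dest: antisymD)
    show "\<alpha> \<le> \<beta> \<or> \<beta> \<le> \<alpha>"
      using L(1,4) unfolding less_eq_ordinal_def
      by (cases "\<alpha> = \<beta>") (simp_all add: total_on_def refl_on_def Rep_ordinal_inject)
  next
    fix P :: "'a ordinal \<Rightarrow> bool" and \<alpha>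
    assume step: "\<And>\<beta>. (\<And>\<gamma>. \<gamma> < \<beta> \<Longrightarrow> P \<gamma>) \<Longrightarrow> P \<beta>"
    have wf: "wf (inv_image (?r - Id) Rep_ordinal)"
      using L(5) by (rule wf_inv_image)
    show "P \<alpha>"
      using wf
    proof (induction \<alpha>)
      case (less \<beta>)
      show ?case
        by (rule step, rule less)
          (auto simp: less_ordinal_def less_eq_ordinal_def in_inv_image Rep_ordinal_inject)
    qed
  qed
qed

end

definition ord_zero :: "'a ordinal" where
  "ord_zero = (LEAST \<alpha>. True)"

definition ord_suc :: "'a ordinal \<Rightarrow> 'a ordinal" where
  "ord_suc \<beta> = (LEAST \<alpha>. \<beta> < \<alpha>)"

definition ord_limit :: "'a ordinal \<Rightarrow> bool" where
  "ord_limit \<alpha> \<longleftrightarrow> \<alpha> \<noteq> ord_zero \<and> (\<forall>\<beta><\<alpha>. \<alpha> \<noteq> ord_suc \<beta>)"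

lemma ord_zero_le [simp]: "ord_zero \<le> \<alpha>"
  unfolding ord_zero_def by (rule Least_le) simp

lemma ordinal_unbounded: "\<exists>\<beta>. (\<alpha> :: 'a ordinal) < \<beta>"
proof -
  let ?r = "card_of (UNIV :: ('a + nat) set set)"
  have inf: "infinite (Field ?r)"
    by (simp add: Field_card_of Finite_Set.finite_set)
  have "Rep_ordinal \<alpha> \<in> Field ?r"
    by (simp add: Field_card_of)
  then obtain b where "b \<noteq> Rep_ordinal \<alpha>" "(Rep_ordinal \<alpha>, b) \<in> ?r"
    using infinite_Card_order_limit[OF card_of_Card_order inf, of "Rep_ordinal \<alpha>"] by metis
  then have "\<alpha> < Abs_ordinal b"
    by (auto simp: less_ordinal_def less_eq_ordinal_def Abs_ordinal_inverse)
  then show ?thesis ..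
qed

lemma less_ord_suc [simp]: "\<beta> < ord_suc \<beta>"
  unfolding ord_suc_def using ordinal_unbounded by (rule LeastI_ex)

lemma ord_suc_le: "\<beta> < \<alpha> \<Longrightarrow> ord_suc \<beta> \<le> \<alpha>"
  unfolding ord_suc_def by (rule Least_le)

lemma ord_suc_inject [simp]: "ord_suc \<alpha> = ord_suc \<beta> \<longleftrightarrow> \<alpha> = \<beta>"
  by (metis leD less_ord_suc linorder_neqE ord_suc_le)

lemma ord_suc_nonzero [simp]: "ord_suc \<alpha> \<noteq> ord_zero"
  by (metis less_ord_suc leD ord_zero_le)

lemma not_ord_limit_suc [simp]: "\<not> ord_limit (ord_suc \<beta>)"
  by (auto simp: ord_limit_def)

lemma not_ord_limit_zero [simp]: "\<not> ord_limit ord_zero"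
  by (simp add: ord_limit_def)

lemma ordinal_cases:
  obtains "\<alpha> = ord_zero" | \<beta> where "\<alpha> = ord_suc \<beta>" | "ord_limit \<alpha>"
  unfolding ord_limit_def by blast


section \<open>Wellordered connected graphs\<close>

text \<open>
  A graph is a vertex set with a symmetric edge relation on it.  Loops are not excluded;
  simple graphs are the special case in which \<open>E\<close> is irreflexive.
\<close>

definition undirected_graph :: "'a set \<Rightarrow> 'a rel \<Rightarrow> bool" where
  "undirected_graph V E \<longleftrightarrow> E \<subseteq> V \<times> V \<and> sym E"

definition connected_graph :: "'a set \<Rightarrow> 'a rel \<Rightarrow> bool" where
  "connected_graph V E \<longleftrightarrow> undirected_graph V E \<and> (\<forall>u\<in>V. \<forall>w\<in>V. (u, w) \<in> E\<^sup>*)"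

text \<open>Following the library, a wellordering is given by its reflexive relation.\<close>

definition wellordered_connected_graph :: "'a set \<Rightarrow> 'a rel \<Rightarrow> 'a rel \<Rightarrow> bool" where
  "wellordered_connected_graph V E r \<longleftrightarrow> connected_graph V E \<and> well_order_on V r"

abbreviation least_elem :: "'a rel \<Rightarrow> 'a set \<Rightarrow> 'a" where
  "least_elem r A \<equiv> wo_rel.minim r A"


section \<open>Deterministic graph search\<close>

definition frontier :: "'a set \<Rightarrow> 'a rel \<Rightarrow> 'a set \<Rightarrow> 'a set" where
  "frontier V E S = {u \<in> V - S. \<exists>w\<in>S. (w, u) \<in> E}"

definition search_step :: "'a set \<Rightarrow> 'a rel \<Rightarrow> 'a rel \<Rightarrow> 'a set \<Rightarrow> 'a set" where
  "search_step V E r S =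
    (if frontier V E S = {} then S else insert (least_elem r (frontier V E S)) S)"

text \<open>
  The first branch also covers index 0, where the union is empty; the recursion equations
  for zero, one, successors and limits are proved below.
\<close>

function search :: "'a set \<Rightarrow> 'a rel \<Rightarrow> 'a rel \<Rightarrow> 'a \<Rightarrow> 'a ordinal \<Rightarrow> 'a set" where
  "search V E r v \<alpha> =
    (if \<forall>\<beta><\<alpha>. \<alpha> \<noteq> ord_suc \<beta> then (\<Union>\<beta>\<in>{..<\<alpha>}. search V E r v \<beta>)
     else if \<alpha> = ord_suc ord_zero then {v}
     else search_step V E r (search V E r v (THE \<beta>. \<alpha> = ord_suc \<beta>)))"
  by pat_completeness auto
termination
  by (relation "inv_image {(\<alpha>, \<beta>). \<alpha> < \<beta>} (\<lambda>(V, E, r, v, \<alpha>). \<alpha>)")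
    (auto simp: wf)

declare search.simps [simp del]

lemma search_zero: "search V E r v ord_zero = {}"
  by (subst search.simps) (auto simp: leD)

lemma search_one: "search V E r v (ord_suc ord_zero) = {v}"
proof -
  have "\<not> (\<forall>\<beta><ord_suc ord_zero. ord_suc ord_zero \<noteq> ord_suc \<beta>)"
    using less_ord_suc by blast
  then show ?thesis by (subst search.simps, subst if_not_P) simp_all
qed

lemma search_suc:
  assumes "\<beta> \<noteq> ord_zero"
  shows "search V E r v (ord_suc \<beta>) = search_step V E r (search V E r v \<beta>)"
proof -
  have "\<not> (\<forall>\<gamma><ord_suc \<beta>. ord_suc \<beta> \<noteq> ord_suc \<gamma>)"
    using less_ord_suc by blast
  then show ?thesis
    using assms by (subst search.simps) (simp only: if_False ord_suc_inject the_eq_trivial the_sym_eq_trivial)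
qed

lemma search_limit:
  assumes "ord_limit \<alpha>"
  shows "search V E r v \<alpha> = (\<Union>\<beta>\<in>{..<\<alpha>}. search V E r v \<beta>)"
  using assms by (subst search.simps) (auto simp: ord_limit_def)

definition entry :: "'a set \<Rightarrow> 'a rel \<Rightarrow> 'a rel \<Rightarrow> 'a \<Rightarrow> 'a \<Rightarrow> 'a ordinal" where
  "entry V E r v u = (LEAST \<alpha>. u \<in> search V E r v \<alpha>)"

definition traversal_from :: "'a set \<Rightarrow> 'a rel \<Rightarrow> 'a rel \<Rightarrow> 'a \<Rightarrow> 'a rel" where
  "traversal_from V E r v =
    {(u, w). u \<in> V \<and> w \<in> V \<and> (u = w \<or> entry V E r v u < entry V E r v w)}"

definition algorithmic_traversal :: "'a set \<Rightarrow> 'a rel \<Rightarrow> 'a rel \<Rightarrow> 'a rel" where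
  "algorithmic_traversal V E r = traversal_from V E r (least_elem r V)"

definition least_neighbor :: "'a set \<Rightarrow> 'a rel \<Rightarrow> 'a rel \<Rightarrow> 'a \<Rightarrow> 'a option" where
  "least_neighbor V E r w =
    (if w \<in> V \<and> w \<noteq> least_elem r V
     then Some (least_elem (algorithmic_traversal V E r) {u \<in> V. (w, u) \<in> E})
     else None)"

lemma search_mono: "\<alpha> \<le> \<beta> \<Longrightarrow> search V E r v \<alpha> \<subseteq> search V E r v \<beta>"
proof (induction \<beta> arbitrary: \<alpha> rule: less_induct)
  case (less \<beta>)
  show ?case
  proof (cases "\<alpha> = \<beta>")
    case False
    with less.prems have lt: "\<alpha> < \<beta>" by simp
    show ?thesis
    proof (cases \<beta> rule: ordinal_cases)
      case 1
      then show ?thesis using lt by (simp add: leD)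
    next
      case (2 \<gamma>)
      have "\<alpha> \<le> \<gamma>"
        using lt 2 ord_suc_le[of \<gamma> \<alpha>] by force
      then have "search V E r v \<alpha> \<subseteq> search V E r v \<gamma>"
        using less.IH[of \<gamma> \<alpha>] 2 by simp
      also have "\<dots> \<subseteq> search V E r v \<beta>"
        using 2 by (cases "\<gamma> = ord_zero") (auto simp: search_zero search_suc search_step_def)
      finally show ?thesis .
    next
      case 3
      then show ?thesis using lt by (auto simp: search_limit)
    qed
  qed simp
qed

lemma least_elem_in:
  assumes "well_order_on V r" "A \<subseteq> V" "A \<noteq> {}"
  shows "least_elem r A \<in> A"
  using assms well_order_on_Well_order[OF assms(1)] wo_rel.minim_in[of r A]
  by (simp add: wo_rel_def)

lemma search_subset:
  assumes "well_order_on V r" "v \<in> V"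
  shows "search V E r v \<alpha> \<subseteq> V"
proof (induction \<alpha> rule: less_induct)
  case (less \<alpha>)
  show ?case
  proof (cases \<alpha> rule: ordinal_cases)
    case (2 \<beta>)
    then have IH: "search V E r v \<beta> \<subseteq> V" using less by simp
    have fr: "frontier V E S \<subseteq> V" for S by (auto simp: frontier_def)
    show ?thesis
    proof (cases "\<beta> = ord_zero")
      case False
      then show ?thesis
        using IH 2 least_elem_in[OF assms(1) fr] fr by (auto simp: search_suc search_step_def)
    qed (use 2 assms in \<open>simp add: search_one\<close>)
  qed (use less in \<open>auto simp: search_zero search_limit\<close>)
qed

lemma vertex_enters:
  fixes V :: "'a set"
  assumes G: "wellordered_connected_graph V E r" and v: "v \<in> V" and u: "u \<in> V"
  shows "\<exists>\<alpha>. u \<in> search V E r v \<alpha>"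
proof (rule ccontr)
  let ?S = "search V E r v"
  assume out: "\<not> ?thesis"
  have W: "well_order_on V r" and conn: "(v, u) \<in> E\<^sup>*" and EV: "E \<subseteq> V \<times> V"
    using G v u
    by (auto simp: wellordered_connected_graph_def connected_graph_def undirected_graph_def)
  have fr: "frontier V E S \<subseteq> V" for S by (auto simp: frontier_def)
  have "\<exists>x. x \<in> ?S (ord_suc \<alpha>) - ?S \<alpha>" for \<alpha>
  proof (cases "\<alpha> = ord_zero")
    case True
    then show ?thesis by (auto simp: search_zero search_one)
  next
    case False
    then have "ord_suc ord_zero \<le> \<alpha>"
      by (metis antisym_conv2 ord_suc_le ord_zero_le)
    then have vS: "v \<in> ?S \<alpha>"
      using search_mono[of "ord_suc ord_zero" \<alpha> V E r v] by (simp add: search_one)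
    have "frontier V E (?S \<alpha>) \<noteq> {}"
    proof
      assume e: "frontier V E (?S \<alpha>) = {}"
      from conn have "u \<in> ?S \<alpha>"
        by (induction rule: rtrancl_induct) (use vS e EV in \<open>auto simp: frontier_def\<close>)
      then show False using out by blast
    qed
    then have "least_elem r (frontier V E (?S \<alpha>)) \<in> ?S (ord_suc \<alpha>) - ?S \<alpha>"
      using least_elem_in[OF W fr[of "?S \<alpha>"]] False
      by (auto simp: search_suc search_step_def frontier_def)
    then show ?thesis ..
  qed
  then obtain f where f: "\<And>\<alpha>. f \<alpha> \<in> ?S (ord_suc \<alpha>) - ?S \<alpha>" by metis
  have neq: "f \<alpha> \<noteq> f \<beta>" if "\<alpha> < \<beta>" for \<alpha> \<beta>
    using f[of \<alpha>] f[of \<beta>] search_mono[OF ord_suc_le[OF that], of V E r v] by auto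
  have "inj f"
    by (rule injI) (metis neq linorder_neqE)
  moreover have "inj (Abs_ordinal :: ('a + nat) set \<Rightarrow> 'a ordinal)"
    by (rule injI) (simp add: Abs_ordinal_inject)
  ultimately have "inj (\<lambda>x. Inl (f (Abs_ordinal x)) :: 'a + nat)"
    by (auto simp: inj_def)
  then obtain g :: "'a + nat \<Rightarrow> ('a + nat) set" where "surj g"
    using inj_imp_surj_inv by blast
  then obtain x where "g x = {x. x \<notin> g x}"
    by (metis surjD)
  then show False by blast
qed

lemma entry_inject:
  assumes u: "u \<in> search V E r v \<alpha>" and w: "w \<in> search V E r v \<beta>"
    and eq: "entry V E r v u = entry V E r v w"
  shows "u = w"
proof -
  let ?S = "search V E r v"
  have in1: "u \<in> ?S (entry V E r v u)"
    unfolding entry_def by (rule LeastI) (rule u)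
  have in2: "w \<in> ?S (entry V E r v u)"
    unfolding eq unfolding entry_def by (rule LeastI) (rule w)
  have out1: "u \<notin> ?S \<gamma>" if "\<gamma> < entry V E r v u" for \<gamma>
    using that unfolding entry_def by (rule not_less_Least)
  have out2: "w \<notin> ?S \<gamma>" if "\<gamma> < entry V E r v u" for \<gamma>
    using that unfolding eq unfolding entry_def by (rule not_less_Least)
  show ?thesis
  proof (cases "entry V E r v u" rule: ordinal_cases)
    case 1
    then show ?thesis using in1 by (simp add: search_zero)
  next
    case (2 \<gamma>)
    then have "u \<notin> ?S \<gamma>" "w \<notin> ?S \<gamma>" using out1 out2 by simp_all
    then show ?thesis
      using in1 in2 2
      by (cases "\<gamma> = ord_zero")
        (auto simp: search_one search_suc search_step_def split: if_splits)
  next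
    case 3
    then show ?thesis using in1 out1 by (auto simp: search_limit)
  qed
qed

lemma traversal_well_order:
  assumes G: "wellordered_connected_graph V E r" and v: "v \<in> V"
  shows "well_order_on V (traversal_from V E r v)"
proof -
  let ?e = "entry V E r v" and ?t = "traversal_from V E r v"
  have inj: "u = w" if "u \<in> V" "w \<in> V" "?e u = ?e w" for u w
    using vertex_enters[OF G v that(1)] vertex_enters[OF G v that(2)] entry_inject that(3) by metis
  have "?t - Id \<subseteq> inv_image {(\<alpha>, \<beta>). \<alpha> < \<beta>} ?e"
    by (auto simp: traversal_from_def)
  then have "wf (?t - Id)"
    by (rule wf_subset[rotated]) (intro wf_inv_image wf)
  moreover have "refl_on V ?t" "trans ?t" "antisym ?t"
    by (auto simp: refl_on_def trans_def antisym_def traversal_from_def)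
  moreover have "?t \<subseteq> V \<times> V"
    by (auto simp: traversal_from_def)
  moreover have "total_on V ?t"
    unfolding total_on_def traversal_from_def using inj by (metis (mono_tags, lifting) case_prodI mem_Collect_eq neq_iff)
  ultimately show ?thesis
    by (simp add: well_order_on_def linear_order_on_def partial_order_on_def preorder_on_def)
qed

end

theory Submission
  imports Defs
begin

text \<open>
  The traversal of a connected graph can be described without ordinal stages: it is the only
  wellordering of the vertices in which each vertex \<open>w\<close> is the one that the search would choose
  when exactly the strict predecessors of \<open>w\<close> have been visited
  (\<open>traversal_from_search_order\<close>, \<open>search_order_unique\<close>).
  Hence it suffices to show that \<open>\<prec>\<close> restricted to \<open>W\<close> has this property for the graph
  induced on \<open>W\<close>.

  Let \<open>w \<in> W\<close> differ from \<open>w0\<close>, let \<open>S\<close> be the set of vertices that strictly precede \<open>w\<close>, and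
  consider the frontier of \<open>S \<inter> W\<close> in the induced graph.  Every vertex of it lies in
  the frontier of \<open>S\<close> in the whole graph, of which \<open>w\<close> is the \<open><\<close>-least element.
  And \<open>w\<close> itself does belong to the smaller frontier: some neighbor of \<open>w\<close> lies in \<open>S\<close>, so the
  \<open>\<prec>\<close>-least neighbor of \<open>w\<close> lies in \<open>S\<close>, and by closure it lies in \<open>W\<close>.
  So \<open>w\<close> is also \<open><\<close>-least in the smaller frontier, and the search in \<open>W\<close> chooses it.
  Connectedness follows because iterating \<open>p\<^sup>\<star>\<close> from any vertex of \<open>W\<close> descends along
  \<open>\<prec>\<close> inside \<open>W\<close>, and can only stop at \<open>w0\<close>.
\<close>

lemma least_elem_lower:
  assumes "well_order_on V r" "A \<subseteq> V" "a \<in> A"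
  shows "(least_elem r A, a) \<in> r"
  using assms well_order_on_Well_order[OF assms(1)] wo_rel.minim_least[of r A a]
  by (simp add: wo_rel_def)

lemma least_elem_eqI:
  assumes "well_order_on V r" "A \<subseteq> V" "a \<in> A" "\<And>b. b \<in> A \<Longrightarrow> (a, b) \<in> r"
  shows "least_elem r A = a"
proof -
  have "wo_rel r" "A \<subseteq> Field r"
    using assms(2) well_order_on_Well_order[OF assms(1)] by (simp_all add: wo_rel_def)
  then show ?thesis
    using wo_rel.equals_minim[of r A a] assms(3,4) by simp
qed

lemma well_order_on_Restr:
  assumes "well_order_on V r" "W \<subseteq> V"
  shows "well_order_on W (Restr r W)"
  using assms well_order_on_Well_order[OF assms(1)] Well_order_Restr[of r W]
    Refl_Field_Restr2[of r W]
  by (simp add: well_order_on_def linear_order_on_def partial_order_on_def preorder_on_def)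

definition next_vertex :: "'a set \<Rightarrow> 'a rel \<Rightarrow> 'a rel \<Rightarrow> 'a \<Rightarrow> 'a set \<Rightarrow> 'a" where
  "next_vertex V E r v S = (if S = {} then v else least_elem r (frontier V E S))"

definition search_order :: "'a set \<Rightarrow> 'a rel \<Rightarrow> 'a rel \<Rightarrow> 'a \<Rightarrow> 'a rel \<Rightarrow> bool" where
  "search_order V E r v t \<longleftrightarrow>
    well_order_on V t \<and> (\<forall>w\<in>V. w = next_vertex V E r v (underS t w))"

text \<open>
  If the two orders have the same strict initial segments below every predecessor of \<open>w\<close> in the
  first order, then the set \<open>A\<close> of these predecessors is an initial segment of the second
  order too; the vertex that follows \<open>A\<close> is determined by \<open>A\<close>, so it is \<open>w\<close> in both.
\<close>

lemma search_order_unique: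
  assumes s: "search_order V E r v s" and t: "search_order V E r v t"
  shows "s = t"
proof -
  have ws: "well_order_on V s" and wt: "well_order_on V t"
    and nx: "\<And>w. w \<in> V \<Longrightarrow> w = next_vertex V E r v (underS s w)"
      "\<And>w. w \<in> V \<Longrightarrow> w = next_vertex V E r v (underS t w)"
    using s t by (auto simp: search_order_def)
  have ps: "refl_on V s" "trans s" "antisym s" "wf (s - Id)" "s \<subseteq> V \<times> V"
    and pt: "refl_on V t" "trans t" "antisym t" "total_on V t" "t \<subseteq> V \<times> V"
    using ws wt
    by (auto simp: well_order_on_def linear_order_on_def partial_order_on_def preorder_on_def)
  have seg: "w \<in> V \<longrightarrow> underS s w = underS t w" for w
    using ps(4)
  proof (induction w rule: wf_induct_rule)
    case (less w)
    show ?case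
    proof
      assume w: "w \<in> V"
      let ?A = "underS s w"
      have IH: "underS s u = underS t u" if "u \<in> ?A" for u
        using less[of u] that ps(5) by (auto simp: underS_def)
      have sub: "underS s u \<subseteq> ?A" if "u \<in> ?A" for u
        using that ps(2,3) unfolding underS_def trans_def antisym_def by blast
      define x where "x = least_elem t (V - ?A)"
      have "w \<in> V - ?A" using w by (auto simp: underS_def)
      then have x: "x \<in> V" "x \<notin> ?A"
        using least_elem_in[OF wt, of "V - ?A"] unfolding x_def by auto
      have xl: "(x, y) \<in> t" if "y \<in> V - ?A" for y
        using least_elem_lower[OF wt _ that] by (auto simp: x_def)
      have "underS t x = ?A"
      proof
        show "underS t x \<subseteq> ?A"
          using xl pt(3,5) unfolding underS_def antisym_def by blast
        show "?A \<subseteq> underS t x"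
        proof
          fix u assume u: "u \<in> ?A"
          then have "u \<in> V" "u \<noteq> x" using ps(5) x by (auto simp: underS_def)
          moreover have "(x, u) \<notin> t"
            using IH[OF u] sub[OF u] x(2) \<open>u \<noteq> x\<close> by (auto simp: underS_def)
          ultimately show "u \<in> underS t x"
            using pt(4) x(1) by (auto simp: underS_def total_on_def)
        qed
      qed
      then have "x = w" using nx(1)[OF w] nx(2)[OF x(1)] by simp
      then show "?A = underS t w" using \<open>underS t x = ?A\<close> by simp
    qed
  qed
  have rep: "q = {(u, w). w \<in> V \<and> (u = w \<or> u \<in> underS q w)}"
    if "refl_on V q" "q \<subseteq> V \<times> V" for q
    using that by (auto simp: underS_def refl_on_def)
  show ?thesis
    by (subst rep[OF ps(1,5)], subst rep[OF pt(1,5)]) (use seg in auto)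
qed

lemma entry_le_iff:
  assumes "u \<in> search V E r v \<alpha>"
  shows "u \<in> search V E r v \<beta> \<longleftrightarrow> entry V E r v u \<le> \<beta>"
proof
  show "entry V E r v u \<le> \<beta>" if "u \<in> search V E r v \<beta>"
    unfolding entry_def using that by (rule Least_le)
  have "u \<in> search V E r v (entry V E r v u)"
    unfolding entry_def using assms by (rule LeastI)
  then show "u \<in> search V E r v \<beta>" if "entry V E r v u \<le> \<beta>"
    using search_mono[OF that] by blast
qed

text \<open>
  A vertex enters at a successor stage, since nothing is new in a union of earlier stages, and
  the stage before contains exactly the vertices that enter strictly earlier.
\<close>

lemma traversal_cases:
  assumes G: "wellordered_connected_graph V E r" and v: "v \<in> V" and w: "w \<in> V"
  defines "S \<equiv> underS (traversal_from V E r v) w"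
  obtains "S = {}" "w = v"
  | "S \<noteq> {}" "w \<in> frontier V E S" "w = least_elem r (frontier V E S)"
proof -
  let ?S = "search V E r v" and ?e = "entry V E r v"
  have W: "well_order_on V r" using G by (simp add: wellordered_connected_graph_def)
  have iff: "u \<in> ?S \<beta> \<longleftrightarrow> ?e u \<le> \<beta>" if "u \<in> V" for u \<beta>
    using vertex_enters[OF G v that] entry_le_iff by metis
  have under: "S = {u \<in> V. ?e u < ?e w}"
    using w by (auto simp: S_def underS_def traversal_from_def)
  have win: "w \<in> ?S (?e w)" using iff w by simp
  show thesis
  proof (cases "?e w" rule: ordinal_cases)
    case 1
    then show thesis using win by (simp add: search_zero)
  next
    case (2 \<beta>)
    have lt: "\<alpha> < ?e w \<longleftrightarrow> \<alpha> \<le> \<beta>" for \<alpha>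
      using 2 less_ord_suc[of \<beta>] ord_suc_le[of \<beta> \<alpha>] by (metis leD le_less_trans linorder_not_le)
    have S: "S = ?S \<beta>"
      using under lt iff search_subset[OF W v] by blast
    show thesis
    proof (cases "\<beta> = ord_zero")
      case True
      then show thesis using that(1) S win 2 by (simp add: search_zero search_one)
    next
      case False
      have out: "w \<notin> S" by (simp add: under)
      have "w \<in> search_step V E r S"
        using win 2 S search_suc[OF False, of V E r v] by simp
      with out have ne: "frontier V E S \<noteq> {}" and wl: "w = least_elem r (frontier V E S)"
        by (simp_all add: search_step_def split: if_splits)
      have "least_elem r (frontier V E S) \<in> frontier V E S"
        using ne by (intro least_elem_in[OF W]) (auto simp: frontier_def)
      then have fr: "w \<in> frontier V E S" using wl by simp
      then have "S \<noteq> {}" by (auto simp: frontier_def)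
      then show thesis using fr wl by (rule that(2))
    qed
  next
    case 3
    then show thesis using win iff[OF w] by (auto simp: search_limit)
  qed
qed

lemma traversal_from_search_order:
  assumes "wellordered_connected_graph V E r" "v \<in> V"
  shows "search_order V E r v (traversal_from V E r v)"
  unfolding search_order_def
proof (intro conjI ballI)
  show "well_order_on V (traversal_from V E r v)"
    using assms by (rule traversal_well_order)
  fix w assume "w \<in> V"
  from traversal_cases[OF assms this]
  show "w = next_vertex V E r v (underS (traversal_from V E r v) w)"
    by cases (simp_all add: next_vertex_def)
qed

text \<open>
  A vertex other than the starting one enters the search from the frontier, hence after one of
  its neighbors, and a fortiori after its \<open>\<prec>\<close>-least one.
\<close>

lemma least_neighbor_precedes:
  assumes G: "wellordered_connected_graph V E r" and p: "least_neighbor V E r w = Some u"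
  shows "(w, u) \<in> E" "u \<in> underS (algorithmic_traversal V E r) w"
proof -
  let ?v = "least_elem r V" and ?t = "algorithmic_traversal V E r"
  let ?N = "{u \<in> V. (w, u) \<in> E}"
  have w: "w \<in> V" "w \<noteq> ?v" and u: "u = least_elem ?t ?N"
    using p by (auto simp: least_neighbor_def split: if_splits)
  have wr: "well_order_on V r" and E: "E \<subseteq> V \<times> V" "sym E"
    using G
    by (auto simp: wellordered_connected_graph_def connected_graph_def undirected_graph_def)
  have v: "?v \<in> V" using least_elem_in[OF wr order.refl] w by blast
  have wt: "well_order_on V ?t"
    unfolding algorithmic_traversal_def using G v by (rule traversal_well_order)
  then have t: "trans ?t" "antisym ?t"
    by (auto simp: well_order_on_def linear_order_on_def partial_order_on_def preorder_on_def)
  have "w \<in> frontier V E (underS ?t w)"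
    using traversal_cases[OF G v w(1)] w(2) unfolding algorithmic_traversal_def by blast
  then obtain x where x: "x \<in> underS ?t w" "(x, w) \<in> E" by (auto simp: frontier_def)
  then have xN: "x \<in> ?N" using E by (auto dest: symD)
  have "u \<in> ?N" using least_elem_in[OF wt, of ?N] xN u by blast
  then show "(w, u) \<in> E" by simp
  have "(u, x) \<in> ?t" using least_elem_lower[OF wt _ xN] u by auto
  then show "u \<in> underS ?t w"
    using x(1) t unfolding underS_def trans_def antisym_def by blast
qed

lemma connected_graph_if_root:
  assumes "undirected_graph V E" "\<And>w. w \<in> V \<Longrightarrow> (w, v) \<in> E\<^sup>*"
  shows "connected_graph V E"
proof -
  have "sym (E\<^sup>*)" using assms(1) by (simp add: undirected_graph_def sym_rtrancl)
  then show ?thesis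
    using assms unfolding connected_graph_def by (meson rtrancl_trans symD)
qed

theorem theorem2p10:
  fixes V W :: "'a set" and E r :: "'a rel" and w0 :: 'a
  assumes graph: "wellordered_connected_graph V E r"
    and nonempty: "V \<noteq> {}"
    and W: "W \<subseteq> V" "W \<noteq> {}"
    and w0: "w0 = least_elem (algorithmic_traversal V E r) W"
    and closed: "\<forall>w\<in>W - {w0}. \<exists>u\<in>W. least_neighbor V E r w = Some u"
  shows "connected_graph W (Restr E W) \<and>
    traversal_from W (Restr E W) (Restr r W) w0 = Restr (algorithmic_traversal V E r) W"
proof -
  let ?v = "least_elem r V" and ?t = "algorithmic_traversal V E r"
  let ?EW = "Restr E W" and ?rW = "Restr r W" and ?tW = "Restr ?t W"
  have wr: "well_order_on V r" and E: "undirected_graph V E"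
    using graph by (auto simp: wellordered_connected_graph_def connected_graph_def)
  have v: "?v \<in> V" using least_elem_in[OF wr order.refl nonempty] .
  have wt: "well_order_on V ?t"
    unfolding algorithmic_traversal_def using graph v by (rule traversal_well_order)
  then have wf: "wf (?t - Id)" and anti: "antisym ?t"
    by (auto simp: well_order_on_def linear_order_on_def partial_order_on_def)
  have w0W: "w0 \<in> W" using least_elem_in[OF wt W] w0 by simp
  have w0_least: "(w0, w) \<in> ?t" if "w \<in> W" for w
    using least_elem_lower[OF wt W(1) that] w0 by simp
  have wrW: "well_order_on W ?rW" using wr W(1) by (rule well_order_on_Restr)
  have under: "underS ?tW w = underS ?t w \<inter> W" if "w \<in> W" for w
    using that by (auto simp: underS_def)

  have parent: "\<exists>u \<in> underS ?t w \<inter> W. (w, u) \<in> ?EW" if "w \<in> W - {w0}" for w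
    using closed that least_neighbor_precedes[OF graph] by blast

  have reach: "w \<in> W \<longrightarrow> (w, w0) \<in> ?EW\<^sup>*" for w
    using wf
  proof (induction w rule: wf_induct_rule)
    case (less w)
    show ?case
    proof
      assume w: "w \<in> W"
      show "(w, w0) \<in> ?EW\<^sup>*"
      proof (cases "w = w0")
        case False
        then obtain u where "u \<in> underS ?t w" "u \<in> W" "(w, u) \<in> ?EW"
          using parent w by blast
        then show ?thesis
          using less[of u] by (auto simp: underS_def intro: converse_rtrancl_into_rtrancl)
      qed simp
    qed
  qed
  have "undirected_graph W ?EW"
    using E by (auto simp: undirected_graph_def sym_def)
  then have conn: "connected_graph W ?EW"
    using reach by (blast intro: connected_graph_if_root)

  have "search_order W ?EW ?rW w0 ?tW"
    unfolding search_order_def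
  proof (intro conjI ballI)
    show "well_order_on W ?tW" using wt W(1) by (rule well_order_on_Restr)
    fix w assume w: "w \<in> W"
    show "w = next_vertex W ?EW ?rW w0 (underS ?tW w)"
    proof (cases "w = w0")
      case True
      then have "underS ?tW w = {}"
        using w0_least anti unfolding underS_def antisym_def by blast
      then show ?thesis using True by (simp add: next_vertex_def)
    next
      case False
      define S where "S = underS ?t w"
      \<comment> \<open>This is the frontier of the search in \<open>W\<close>; it contains \<open>w\<close> by closure under \<open>p\<^sup>\<star>\<close>.\<close>
      let ?F = "frontier W ?EW (S \<inter> W)"
      obtain u where u: "u \<in> S \<inter> W" "(w, u) \<in> ?EW"
        using parent w False unfolding S_def by blast
      have sub: "?F \<subseteq> frontier V E S" using W(1) by (auto simp: frontier_def)
      have wF: "w \<in> ?F"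
        using u w E by (auto simp: frontier_def S_def underS_def undirected_graph_def dest: symD)
      have least: "w = least_elem r (frontier V E S)"
        using traversal_cases[OF graph v, of w] w W(1) u(1)
        unfolding S_def algorithmic_traversal_def by blast
      have "least_elem ?rW ?F = w"
      proof (rule least_elem_eqI[OF wrW _ wF])
        show "?F \<subseteq> W" by (auto simp: frontier_def)
        fix x assume x: "x \<in> ?F"
        then have "(w, x) \<in> r"
          using least_elem_lower[OF wr, of "frontier V E S" x] sub least
          by (auto simp: frontier_def)
        then show "(w, x) \<in> ?rW" using x w by (auto simp: frontier_def)
      qed
      then show ?thesis using under[OF w] u(1) by (auto simp: next_vertex_def S_def)
    qed
  qed
  moreover have "search_order W ?EW ?rW w0 (traversal_from W ?EW ?rW w0)"
    using conn wrW w0W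
    by (intro traversal_from_search_order) (simp_all add: wellordered_connected_graph_def)
  ultimately have "traversal_from W ?EW ?rW w0 = ?tW"
    by (rule search_order_unique[rotated])
  with conn show ?thesis ..
qed

end
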